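(* Let $D=\{(a_0,a_1,a_2)\in\mathbb R^3\mid 0\leqslant a_0,\ a_1^2+a_2^2\leqslant a_0^2\}$ be the circular cone. There exists a sequence $(M^{(k)})_{k\geqslant1}$ of linear matrix inequality definitions $M^{(k)}=(M^{(k)}_0,M^{(k)}_1,M^{(k)}_2)$ of $D$, of which none is a sum of compressions of the previous one; that is, for every $k\geqslant1$, $M^{(k+1)}$ is not a sum of compressions of $M^{(k)}$.
   Context: A tuple $(M_0,M_1,M_2)$ of Hermitian complex matrices of the same size (the size may differ from tuple to tuple) is a linear matrix inequality definition of $D$ if $D=\{a\in\mathbb R^3\mid a_0M_0+a_1M_1+a_2M_2\geqslant0\}$, where $\geqslant0$ means positive semidefinite. A tuple $(N_0,N_1,N_2)$ of Hermitian $n\times n$ matrices is a sum of compressions of a tuple $(M_0,M_1,M_2)$ of Hermitian $r\times r$ matrices if there are finitely many complex $r\times n$ matrices $V_j$ with $\sum_jV_j^*M_iV_j=N_i$ for $i=0,1,2$. *)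

theory Defs
  imports "Jordan_Normal_Form.Schur_Decomposition"
begin

type_synonym mat_triple = "complex mat \<times> complex mat \<times> complex mat"

definition hermitian_mat :: "nat \<Rightarrow> complex mat \<Rightarrow> bool" where
  "hermitian_mat n A \<longleftrightarrow> A \<in> carrier_mat n n \<and> mat_adjoint A = A"

text \<open>The inequality is in the order of \<^theory>\<open>HOL-Library.Complex_Order\<close>, where
  \<^prop>\<open>(0::complex) \<le> z\<close> says that \<^term>\<open>z::complex\<close> is real and nonnegative; the operation
  \<^term>\<open>cscalar_prod\<close> conjugates its second argument, so that the right-hand side is
  the value at \<open>v\<close> of the Hermitian form of \<open>A\<close>.\<close>

definition psd_mat :: "nat \<Rightarrow> complex mat \<Rightarrow> bool" where
  "psd_mat n A \<longleftrightarrow> hermitian_mat n A \<and> (\<forall>v \<in> carrier_vec n. 0 \<le> (A *\<^sub>v v) \<bullet>c v)"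

definition hermitian_triple :: "nat \<Rightarrow> mat_triple \<Rightarrow> bool" where
  "hermitian_triple n = (\<lambda>(M0, M1, M2).
     hermitian_mat n M0 \<and> hermitian_mat n M1 \<and> hermitian_mat n M2)"

definition linear_pencil :: "mat_triple \<Rightarrow> real \<times> real \<times> real \<Rightarrow> complex mat" where
  "linear_pencil = (\<lambda>(M0, M1, M2) (a0, a1, a2).
     complex_of_real a0 \<cdot>\<^sub>m M0 + complex_of_real a1 \<cdot>\<^sub>m M1 + complex_of_real a2 \<cdot>\<^sub>m M2)"

definition lmi_definition :: "(real \<times> real \<times> real) set \<Rightarrow> mat_triple \<Rightarrow> bool" where
  "lmi_definition D M \<longleftrightarrow>
     (\<exists>n. hermitian_triple n M \<and> D = {a. psd_mat n (linear_pencil M a)})"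

definition compression_sum ::
    "nat \<Rightarrow> nat \<Rightarrow> (nat \<Rightarrow> complex mat) \<Rightarrow> complex mat \<Rightarrow> complex mat" where
  "compression_sum n m V A =
     (\<Oplus>\<^bsub>module_mat TYPE(complex) n n\<^esub> j \<in> {..<m}. mat_adjoint (V j) * A * V j)"

definition sum_of_compressions :: "mat_triple \<Rightarrow> mat_triple \<Rightarrow> bool" where
  "sum_of_compressions = (\<lambda>(N0, N1, N2) (M0, M1, M2).
     \<exists>n r. hermitian_triple n (N0, N1, N2) \<and> hermitian_triple r (M0, M1, M2) \<and>
       (\<exists>m V. (\<forall>j<m. V j \<in> carrier_mat r n) \<and>
          compression_sum n m V M0 = N0 \<and>
          compression_sum n m V M1 = N1 \<and>
          compression_sum n m V M2 = N2))"

definition circular_cone :: "(real \<times> real \<times> real) set" where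
  "circular_cone = {(a0, a1, a2). 0 \<le> a0 \<and> a1\<^sup>2 + a2\<^sup>2 \<le> a0\<^sup>2}"

end

theory Submission
  imports Defs
begin

text \<open>
  A triple \<open>(1, M\<^sub>1, M\<^sub>2)\<close> is encoded by the single matrix \<open>T = M\<^sub>1 + \<i> M\<^sub>2\<close>; it defines the circular
  cone exactly when the numerical range of \<open>T\<close> is the closed unit disc.

  If a triple \<open>(1, N\<^sub>1, N\<^sub>2)\<close> is a sum of compressions of it by matrices \<open>V\<^sub>j\<close>, then \<open>\<Sum>\<^sub>j V\<^sub>j\<^sup>* V\<^sub>j = 1\<close>, so that \<open>X \<mapsto> \<Sum>\<^sub>j V\<^sub>j\<^sup>* X V\<^sub>j\<close> is a contraction for the operator norm, and
  \<open>N\<^sub>1 + \<i> N\<^sub>2\<close> has at most the norm of \<open>T\<close>. It therefore suffices to find matrices that all have the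
  unit disc as numerical range and whose norms increase strictly.

  The weighted shifts \<open>e\<^sub>2 \<mapsto> 2 cos \<theta> e\<^sub>1\<close>, \<open>e\<^sub>3 \<mapsto> 2 sin \<theta> e\<^sub>2\<close> have this property: the
  numerical radius depends only on the sum of the squares of the two weights, here \<open>4\<close>, while
  the norm is the larger weight, \<open>2 cos \<theta>\<close> for \<open>0 \<le> \<theta> \<le> \<pi>/4\<close>. The lemma
  \<open>lmi_definition_shift_triple\<close> says the first, the lemma \<open>sum_of_compressions_shift_triple_le\<close>
  is the comparison of norms, and the angles \<open>\<theta> = \<pi> / (4 k)\<close> give the sequence.
\<close>

section \<open>Entries of sums of compressions\<close>

lemma mat_adjoint_carrier:
  fixes A :: "complex mat"
  assumes "A \<in> carrier_mat r n"
  shows "mat_adjoint A \<in> carrier_mat n r"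
  using assms by (auto simp: mat_adjoint_def)

lemma mat_adjoint_index:
  fixes A :: "complex mat"
  assumes "A \<in> carrier_mat r n" "i < n" "j < r"
  shows "mat_adjoint A $$ (i, j) = cnj (A $$ (j, i))"
  using assms by (auto simp: mat_adjoint_def mat_of_rows_def)

lemma compression_index:
  fixes A V :: "complex mat"
  assumes A: "A \<in> carrier_mat r r" and V: "V \<in> carrier_mat r n" and ij: "i < n" "j < n"
  shows "(mat_adjoint V * A * V) $$ (i, j) = (A *\<^sub>v col V j) \<bullet>c col V i"
proof -
  have V': "mat_adjoint V \<in> carrier_mat n r"
    using V by (rule mat_adjoint_carrier)
  have row: "row (mat_adjoint V) i = conjugate (col V i)"
    using V V' ij by (intro eq_vecI) (auto simp: mat_adjoint_index)
  have Av: "A *\<^sub>v col V j \<in> carrier_vec r"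
    using A V ij by (intro mult_mat_vec_carrier) auto
  have "(mat_adjoint V * A * V) $$ (i, j) = (mat_adjoint V * (A * V)) $$ (i, j)"
    using A V V' by (subst assoc_mult_mat) auto
  also have "\<dots> = row (mat_adjoint V) i \<bullet> col (A * V) j"
    using V V' ij by (intro index_mult_mat) auto
  also have "\<dots> = row (mat_adjoint V) i \<bullet> (A *\<^sub>v col V j)"
    by (simp only: col_mult2[OF A V ij(2)])
  also have "\<dots> = (A *\<^sub>v col V j) \<bullet>c col V i"
    unfolding row using Av V ij by (intro comm_scalar_prod[of _ r]) auto
  finally show ?thesis .
qed

lemma finsum_mat_index:
  fixes F :: "nat \<Rightarrow> complex mat"
  assumes F: "\<And>k. k < m \<Longrightarrow> F k \<in> carrier_mat n n" and ij: "i < n" "j < n"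
  shows "(\<Oplus>\<^bsub>module_mat TYPE(complex) n n\<^esub> k \<in> {..<m}. F k) $$ (i, j) = (\<Sum>k<m. F k $$ (i, j))"
  using F
proof (induction m)
  interpret abelian_group "module_mat TYPE(complex) n n" by (rule abelian_group_mat)
  {
    case 0
    then show ?case using ij by (simp add: module_mat_simps)
  next
    case (Suc m)
    have closed: "(\<Oplus>\<^bsub>module_mat TYPE(complex) n n\<^esub> k \<in> {..<m}. F k) \<in> carrier_mat n n"
      using finsum_closed[of F "{..<m}"] Suc.prems by (auto simp: module_mat_simps Pi_def)
    have "(\<Oplus>\<^bsub>module_mat TYPE(complex) n n\<^esub> k \<in> {..<Suc m}. F k)
        = F m + (\<Oplus>\<^bsub>module_mat TYPE(complex) n n\<^esub> k \<in> {..<m}. F k)"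
      using finsum_insert[of "{..<m}" m F] Suc.prems
      by (auto simp: module_mat_simps Pi_def lessThan_Suc)
    then show ?case using Suc closed ij by (simp add: add.commute)
  }
qed

lemma compression_sum_index:
  assumes "A \<in> carrier_mat r r" "\<And>k. k < m \<Longrightarrow> V k \<in> carrier_mat r n" "i < n" "j < n"
  shows "compression_sum n m V A $$ (i, j) = (\<Sum>k<m. (A *\<^sub>v col (V k) j) \<bullet>c col (V k) i)"
proof -
  have "mat_adjoint (V k) * A * V k \<in> carrier_mat n n" if "k < m" for k
    using assms(1) assms(2)[OF that] mat_adjoint_carrier[OF assms(2)[OF that]]
    by (intro mult_carrier_mat[of _ n r]) auto
  then have "compression_sum n m V A $$ (i, j) = (\<Sum>k<m. (mat_adjoint (V k) * A * V k) $$ (i, j))"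
    unfolding compression_sum_def using assms(3,4) by (intro finsum_mat_index)
  also have "\<dots> = (\<Sum>k<m. (A *\<^sub>v col (V k) j) \<bullet>c col (V k) i)"
    using assms by (intro sum.cong refl compression_index[of A r]) auto
  finally show ?thesis .
qed

section \<open>The triples of weighted shifts\<close>

text \<open>This is \<open>a 1 + Re (2 c S)\<close>, where \<open>S\<close> is the shift with weights \<open>p\<close> and \<open>q\<close> and \<open>Re\<close>
  is the Hermitian part, so that \<open>T = 2 S\<close> for the triple below. Being real linear in \<open>(a, c)\<close>, it gives the three matrices of the
  triple and all values of its pencil at once.\<close>

definition shift_pencil :: "real \<Rightarrow> real \<Rightarrow> real \<Rightarrow> complex \<Rightarrow> complex mat" where
  "shift_pencil p q a c = mat_of_rows_list 3
     [[of_real a, c * p, 0],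
      [cnj c * p, of_real a, c * q],
      [0, cnj c * q, of_real a]]"

definition shift_triple :: "real \<Rightarrow> real \<Rightarrow> mat_triple" where
  "shift_triple p q = (shift_pencil p q 1 0, shift_pencil p q 0 1, shift_pencil p q 0 (- \<i>))"

lemma less_3_cases: "i < 3 \<Longrightarrow> i = 0 \<or> i = 1 \<or> i = (2::nat)"
  by auto

lemma shift_pencil_carrier: "shift_pencil p q a c \<in> carrier_mat 3 3"
  by (auto simp: shift_pencil_def mat_of_rows_list_def)

lemma hermitian_mat_shift_pencil: "hermitian_mat 3 (shift_pencil p q a c)"
  unfolding hermitian_mat_def
proof (intro conjI shift_pencil_carrier eq_matI)
  fix i j
  assume "i < dim_row (shift_pencil p q a c)" "j < dim_col (shift_pencil p q a c)"
  then have ij: "i < 3" "j < 3" using shift_pencil_carrier[of p q a c] by auto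
  then show "mat_adjoint (shift_pencil p q a c) $$ (i, j) = shift_pencil p q a c $$ (i, j)"
    by (subst mat_adjoint_index[OF shift_pencil_carrier])
      (auto dest!: less_3_cases simp: shift_pencil_def mat_of_rows_list_def)
qed (simp_all add: mat_adjoint_def shift_pencil_def mat_of_rows_list_def)

lemma hermitian_triple_shift_triple: "hermitian_triple 3 (shift_triple p q)"
  by (simp add: hermitian_triple_def shift_triple_def hermitian_mat_shift_pencil)

lemma linear_pencil_shift_triple:
  "linear_pencil (shift_triple p q) (a0, a1, a2) = shift_pencil p q a0 (Complex a1 (- a2))"
  (is "?L = ?R")
proof (rule eq_matI)
  fix i j
  assume "i < dim_row ?R" "j < dim_col ?R"
  then have "i < 3" "j < 3" using shift_pencil_carrier[of p q a0 "Complex a1 (- a2)"] by auto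
  then show "?L $$ (i, j) = ?R $$ (i, j)"
    unfolding linear_pencil_def shift_triple_def
    by (auto dest!: less_3_cases simp: shift_pencil_def mat_of_rows_list_def complex_eq_iff)
qed (simp_all add: linear_pencil_def shift_triple_def shift_pencil_def mat_of_rows_list_def)

lemma shift_pencil_sesquilinear_form:
  assumes "v \<in> carrier_vec 3" "w \<in> carrier_vec 3"
  shows "(shift_pencil p q a c *\<^sub>v v) \<bullet>c w =
      a * (v $ 0 * cnj (w $ 0) + v $ 1 * cnj (w $ 1) + v $ 2 * cnj (w $ 2))
    + c * (p * v $ 1 * cnj (w $ 0) + q * v $ 2 * cnj (w $ 1))
    + cnj c * (p * v $ 0 * cnj (w $ 1) + q * v $ 1 * cnj (w $ 2))"
proof -
  have sum3: "(\<Sum>k = 0..<3. f k) = f 0 + f 1 + f 2" for f :: "nat \<Rightarrow> complex"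
    by (simp add: eval_nat_numeral)
  let ?H = "shift_pencil p q a c"
  have "(?H *\<^sub>v v) \<bullet>c w = (\<Sum>i = 0..<3. (?H *\<^sub>v v) $ i * cnj (w $ i))"
    using assms(2) by (auto simp: scalar_prod_def intro!: sum.cong)
  also have "\<dots> = (\<Sum>i = 0..<3. (\<Sum>k = 0..<3. ?H $$ (i, k) * v $ k) * cnj (w $ i))"
    using assms(1) shift_pencil_carrier[of p q a c]
    by (intro sum.cong) (auto simp: scalar_prod_def intro!: sum.cong)
  finally show ?thesis
    unfolding sum3
    by (simp add: shift_pencil_def mat_of_rows_list_def distrib_left distrib_right mult_ac)
qed

lemma shift_pencil_hermitian_form:
  assumes "v \<in> carrier_vec 3"
  shows "(shift_pencil p q a c *\<^sub>v v) \<bullet>c v = complex_of_real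
    (a * ((cmod (v $ 0))\<^sup>2 + (cmod (v $ 1))\<^sup>2 + (cmod (v $ 2))\<^sup>2)
      + 2 * Re (c * (p * v $ 1 * cnj (v $ 0) + q * v $ 2 * cnj (v $ 1))))"
  unfolding shift_pencil_sesquilinear_form[OF assms assms]
  by (simp add: complex_eq_iff cmod_power2) (simp add: power2_eq_square algebra_simps)

section \<open>They define the circular cone\<close>

text \<open>By Cauchy-Schwarz, the left-hand side is at most
  \<open>2 \<bar>c\<bar> \<bar>y\<bar> sqrt (\<bar>x\<bar>\<^sup>2 + \<bar>z\<bar>\<^sup>2) \<le> \<bar>c\<bar> (\<bar>x\<bar>\<^sup>2 + \<bar>y\<bar>\<^sup>2 + \<bar>z\<bar>\<^sup>2)\<close>.
  Only \<open>p\<^sup>2 + q\<^sup>2\<close> enters, which is why the cone does not depend on the individual weights.\<close>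

lemma shift_form_bound:
  fixes x y z c :: complex and p q :: real
  assumes weights: "p\<^sup>2 + q\<^sup>2 = 1"
  shows "2 * cmod (c * (p * y * cnj x + q * z * cnj y))
    \<le> cmod c * ((cmod x)\<^sup>2 + (cmod y)\<^sup>2 + (cmod z)\<^sup>2)"
proof -
  define s where "s = \<bar>p\<bar> * cmod x + \<bar>q\<bar> * cmod z"
  have "(cmod x)\<^sup>2 + (cmod z)\<^sup>2 - s\<^sup>2 = (\<bar>q\<bar> * cmod x - \<bar>p\<bar> * cmod z)\<^sup>2"
  proof -
    have "(cmod x)\<^sup>2 + (cmod z)\<^sup>2 = (\<bar>q\<bar>\<^sup>2 + \<bar>p\<bar>\<^sup>2) * ((cmod x)\<^sup>2 + (cmod z)\<^sup>2)"
      using weights by (simp add: add.commute)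
    then show ?thesis
      by (simp only: s_def power2_eq_square) (simp add: algebra_simps)
  qed
  then have s: "s\<^sup>2 \<le> (cmod x)\<^sup>2 + (cmod z)\<^sup>2"
    using zero_le_power2[of "\<bar>q\<bar> * cmod x - \<bar>p\<bar> * cmod z"] by linarith
  have "cmod (p * y * cnj x + q * z * cnj y) \<le> cmod y * s"
    by (rule order_trans[OF norm_triangle_ineq]) (simp add: s_def norm_mult algebra_simps)
  moreover have "2 * (cmod y * s) \<le> (cmod y)\<^sup>2 + s\<^sup>2"
    using zero_le_power2[of "cmod y - s"] by (simp add: power2_diff)
  ultimately have "2 * cmod (p * y * cnj x + q * z * cnj y)
      \<le> (cmod x)\<^sup>2 + (cmod y)\<^sup>2 + (cmod z)\<^sup>2"
    using s by linarith
  from mult_left_mono[OF this, of "cmod c"] show ?thesis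
    by (simp only: norm_mult[of c] mult.left_commute) simp
qed

lemma psd_mat_shift_pencil_iff:
  assumes weights: "p\<^sup>2 + q\<^sup>2 = 1"
  shows "psd_mat 3 (shift_pencil p q a c) \<longleftrightarrow> cmod c \<le> a"
proof
  assume psd: "psd_mat 3 (shift_pencil p q a c)"
  obtain u where u: "cmod u = 1" "c * u = of_real (cmod c)"
  proof (cases "c = 0")
    case True
    then show ?thesis using that[of 1] by simp
  next
    case False
    show ?thesis
    proof (rule that[of "of_real (cmod c) / c"])
      show "cmod (of_real (cmod c) / c) = 1" using False by (simp add: norm_divide)
    qed (use False in simp)
  qed
  \<comment> \<open>Equality in \<open>shift_form_bound\<close> needs \<open>(\<bar>x\<bar>, \<bar>y\<bar>, \<bar>z\<bar>)\<close> proportional to \<open>(\<bar>p\<bar>, 1, \<bar>q\<bar>)\<close>;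
    the phase \<open>u\<close> makes both off-diagonal terms negative.\<close>
  define v where "v = vec 3 ((!) [- p * cnj u, 1, - q * u])"
  have v: "v \<in> carrier_vec 3"
    by (simp add: v_def)
  have v_index: "v $ 0 = - p * cnj u" "v $ 1 = 1" "v $ 2 = - q * u"
    by (simp_all add: v_def)
  have "c * (p * v $ 1 * cnj (v $ 0) + q * v $ 2 * cnj (v $ 1))
      = - (c * u) * of_real ((p)\<^sup>2 + (q)\<^sup>2)"
    unfolding v_index of_real_add of_real_power by (simp add: algebra_simps power2_eq_square)
  then have off: "Re (c * (p * v $ 1 * cnj (v $ 0) + q * v $ 2 * cnj (v $ 1))) = - cmod c"
    by (simp add: u weights)
  have diag: "(cmod (v $ 0))\<^sup>2 + (cmod (v $ 1))\<^sup>2 + (cmod (v $ 2))\<^sup>2 = 2"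
    unfolding v_index using weights by (simp add: norm_mult u)
  have "0 \<le> (shift_pencil p q a c *\<^sub>v v) \<bullet>c v"
    using psd v by (auto simp: psd_mat_def)
  then have "0 \<le> a * 2 + 2 * - cmod c"
    unfolding shift_pencil_hermitian_form[OF v] off diag by (simp add: less_eq_complex_def)
  then show "cmod c \<le> a" by simp
next
  assume c: "cmod c \<le> a"
  show "psd_mat 3 (shift_pencil p q a c)"
    unfolding psd_mat_def
  proof (intro conjI ballI hermitian_mat_shift_pencil)
    fix v :: "complex vec"
    assume v: "v \<in> carrier_vec 3"
    let ?n = "(cmod (v $ 0))\<^sup>2 + (cmod (v $ 1))\<^sup>2 + (cmod (v $ 2))\<^sup>2"
    let ?w = "c * (p * v $ 1 * cnj (v $ 0) + q * v $ 2 * cnj (v $ 1))"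
    have "2 * cmod ?w \<le> cmod c * ?n"
      using weights by (rule shift_form_bound)
    also have "\<dots> \<le> a * ?n"
      using c by (intro mult_right_mono) auto
    finally have "0 \<le> a * ?n + 2 * Re ?w"
      using abs_Re_le_cmod[of ?w] by linarith
    then show "0 \<le> (shift_pencil p q a c *\<^sub>v v) \<bullet>c v"
      unfolding shift_pencil_hermitian_form[OF v] by (simp add: less_eq_complex_def)
  qed
qed

lemma lmi_definition_shift_triple:
  assumes weights: "p\<^sup>2 + q\<^sup>2 = 1"
  shows "lmi_definition circular_cone (shift_triple p q)"
proof -
  have "a \<in> circular_cone \<longleftrightarrow> psd_mat 3 (linear_pencil (shift_triple p q) a)" for a
  proof (cases a)
    case (fields a0 a1 a2)
    have "sqrt (a1\<^sup>2 + a2\<^sup>2) \<le> a0 \<longleftrightarrow> 0 \<le> a0 \<and> a1\<^sup>2 + a2\<^sup>2 \<le> a0\<^sup>2"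
      by (metis real_sqrt_ge_0_iff order_trans real_le_lsqrt sqrt_le_D sum_power2_ge_zero)
    then show ?thesis
      by (simp add: fields circular_cone_def linear_pencil_shift_triple psd_mat_shift_pencil_iff[OF weights]
          cmod_def)
  qed
  then show ?thesis
    unfolding lmi_definition_def using hermitian_triple_shift_triple by blast
qed

section \<open>Compressions do not increase the norm\<close>

text \<open>The first two columns \<open>w\<^sub>k\<close> and \<open>v\<^sub>k\<close> of the compressing matrices \<open>V\<^sub>k\<close> have squared norms
  summing to \<open>1\<close>, because the first matrix of both triples is the identity. The \<open>(0, 1)\<close> entry
  of \<open>N\<^sub>1 + \<i> N\<^sub>2\<close> is \<open>2 p'\<close>, and equals \<open>\<Sum>\<^sub>k \<langle>T v\<^sub>k, w\<^sub>k\<rangle>\<close> for the shift \<open>T\<close> of the compressed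
  triple, whose norm is its larger weight \<open>2 p\<close>.\<close>

lemma sum_of_compressions_shift_triple_le:
  assumes weights: "0 \<le> q" "q \<le> p"
    and sum: "sum_of_compressions (shift_triple p' q') (shift_triple p q)"
  shows "p' \<le> p"
proof -
  obtain n r m V where n: "hermitian_triple n (shift_triple p' q')"
    and r: "hermitian_triple r (shift_triple p q)"
    and V: "\<forall>k<m. V k \<in> carrier_mat r n"
    and N: "compression_sum n m V (shift_pencil p q 1 0) = shift_pencil p' q' 1 0"
      "compression_sum n m V (shift_pencil p q 0 1) = shift_pencil p' q' 0 1"
      "compression_sum n m V (shift_pencil p q 0 (- \<i>)) = shift_pencil p' q' 0 (- \<i>)"
    using sum unfolding sum_of_compressions_def shift_triple_def by auto
  have "n = 3" "r = 3"
    using n r shift_pencil_carrier[of p' q' 1 0] shift_pencil_carrier[of p q 1 0]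
    by (auto simp: hermitian_triple_def shift_triple_def hermitian_mat_def)
  with V have V: "V k \<in> carrier_mat 3 3" if "k < m" for k
    using that by auto
  note N = N[unfolded \<open>n = 3\<close>]
  define w where "w k = col (V k) 0" for k
  define v where "v k = col (V k) 1" for k
  have carrier: "w k \<in> carrier_vec 3" "v k \<in> carrier_vec 3" if "k < m" for k
    using V[OF that] by (auto simp: w_def v_def intro!: carrier_vecI)
  define sq where "sq x = (cmod (x $ 0))\<^sup>2 + (cmod (x $ 1))\<^sup>2 + (cmod (x $ 2))\<^sup>2" for x :: "complex vec"
  have entry: "shift_pencil p' q' a c $$ (i, j)
      = (\<Sum>k<m. (shift_pencil p q a c *\<^sub>v col (V k) j) \<bullet>c col (V k) i)"
    if "compression_sum 3 m V (shift_pencil p q a c) = shift_pencil p' q' a c" "i < 3" "j < 3"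
    for a c i j
    using compression_sum_index[OF shift_pencil_carrier, of m V 3 i j p q a c] V that by simp
  have sum_col: "(\<Sum>k<m. sq (col (V k) i)) = 1" if "i < 3" for i
  proof -
    have "complex_of_real (\<Sum>k<m. sq (col (V k) i)) = shift_pencil p' q' 1 0 $$ (i, i)"
      unfolding entry[OF N(1) that that] of_real_sum
    proof (intro sum.cong refl)
      fix k
      assume "k \<in> {..<m}"
      then have "col (V k) i \<in> carrier_vec 3"
        using V[of k] by (auto intro!: carrier_vecI)
      then show "complex_of_real (sq (col (V k) i))
          = (shift_pencil p q 1 0 *\<^sub>v col (V k) i) \<bullet>c col (V k) i"
        by (simp add: shift_pencil_hermitian_form sq_def)
    qed
    also have "\<dots> = 1"
      using less_3_cases[OF that] by (auto simp: shift_pencil_def mat_of_rows_list_def)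
    finally show ?thesis
      by (simp only: of_real_eq_1_iff)
  qed
  have sum_w: "(\<Sum>k<m. sq (w k)) = 1" and sum_v: "(\<Sum>k<m. sq (v k)) = 1"
    using sum_col[of 0] sum_col[of 1] by (simp_all add: w_def v_def)
  define f where "f k = p * v k $ 1 * cnj (w k $ 0) + q * v k $ 2 * cnj (w k $ 1)" for k
  have "shift_pencil p' q' 0 1 $$ (0, 1) + \<i> * shift_pencil p' q' 0 (- \<i>) $$ (0, 1)
      = (\<Sum>k<m. (shift_pencil p q 0 1 *\<^sub>v v k) \<bullet>c w k + \<i> * ((shift_pencil p q 0 (- \<i>) *\<^sub>v v k) \<bullet>c w k))"
    by (simp add: entry[OF N(2)] entry[OF N(3)] sum.distrib sum_distrib_left v_def w_def)
  \<comment> \<open>As \<open>c + \<i> c'\<close> is \<open>2\<close> and \<open>cnj c + \<i> cnj c'\<close> is \<open>0\<close> for \<open>c = 1\<close> and \<open>c' = - \<i>\<close>, only the terms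
    above the diagonal survive.\<close>
  also have "\<dots> = (\<Sum>k<m. 2 * f k)"
    by (intro sum.cong)
      (simp_all add: shift_pencil_sesquilinear_form carrier f_def algebra_simps)
  finally have "p' = (\<Sum>k<m. f k)"
    by (simp add: shift_pencil_def mat_of_rows_list_def sum_distrib_left[symmetric])
  then have "p' \<le> cmod (\<Sum>k<m. f k)"
    by (metis abs_ge_self norm_of_real)
  also have "\<dots> \<le> (\<Sum>k<m. cmod (f k))"
    by (rule norm_sum)
  also have "\<dots> \<le> (\<Sum>k<m. p * ((sq (v k) + sq (w k)) / 2))"
  proof (rule sum_mono)
    fix k
    have amgm: "x * y \<le> (x\<^sup>2 + y\<^sup>2) / 2" for x y :: real
      using zero_le_power2[of "x - y"] by (simp add: power2_diff)
    have "cmod (f k) \<le> p * (cmod (v k $ 1) * cmod (w k $ 0))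
        + q * (cmod (v k $ 2) * cmod (w k $ 1))"
      unfolding f_def using weights
      by (intro order_trans[OF norm_triangle_ineq]) (simp add: norm_mult)
    also have "\<dots> \<le> p * (cmod (v k $ 1) * cmod (w k $ 0))
        + p * (cmod (v k $ 2) * cmod (w k $ 1))"
      using weights by (intro add_left_mono mult_right_mono) auto
    also have "\<dots> = p * (cmod (v k $ 1) * cmod (w k $ 0) + cmod (v k $ 2) * cmod (w k $ 1))"
      by (simp add: algebra_simps)
    also have "\<dots> \<le> p * ((sq (v k) + sq (w k)) / 2)"
    proof (rule mult_left_mono)
      show "cmod (v k $ 1) * cmod (w k $ 0) + cmod (v k $ 2) * cmod (w k $ 1)
          \<le> (sq (v k) + sq (w k)) / 2"
        using amgm[of "cmod (v k $ 1)" "cmod (w k $ 0)"] amgm[of "cmod (v k $ 2)" "cmod (w k $ 1)"]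
          zero_le_power2[of "cmod (v k $ 0)"] zero_le_power2[of "cmod (w k $ 2)"]
        unfolding sq_def by argo
    qed (use weights in linarith)
    finally show "cmod (f k) \<le> p * ((sq (v k) + sq (w k)) / 2)" .
  qed
  also have "\<dots> = p"
    by (simp add: sum_distrib_left[symmetric] sum_divide_distrib[symmetric] sum.distrib sum_v sum_w)
  finally show ?thesis .
qed

theorem corollary3p9:
  shows "\<exists>M :: nat \<Rightarrow> mat_triple.
    (\<forall>k\<ge>1. lmi_definition circular_cone (M k)) \<and>
    (\<forall>k\<ge>1. \<not> sum_of_compressions (M (k + 1)) (M k))"
proof -
  define \<theta> where "\<theta> k = pi / (4 * real k)" for k :: nat
  define M where "M k = shift_triple (cos (\<theta> k)) (sin (\<theta> k))" for k
  have "\<not> sum_of_compressions (M (k + 1)) (M k)" if "k \<ge> 1" for k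
  proof
    assume sum: "sum_of_compressions (M (k + 1)) (M k)"
    have \<theta>: "0 \<le> \<theta> (k + 1)" "\<theta> (k + 1) < \<theta> k" "\<theta> k \<le> pi / 4"
      using that by (auto simp: \<theta>_def field_simps)
    have "sin (\<theta> k) \<le> sin (pi / 4)"
      using \<theta> by (intro sin_monotone_2pi_le) auto
    also have "\<dots> = cos (pi / 4)"
      by (simp add: sin_45 cos_45)
    also have "\<dots> \<le> cos (\<theta> k)"
      using \<theta> by (intro cos_monotone_0_pi_le) auto
    finally have "sin (\<theta> k) \<le> cos (\<theta> k)" .
    moreover have "0 \<le> sin (\<theta> k)"
      using \<theta> by (intro sin_ge_zero) auto
    ultimately have "cos (\<theta> (k + 1)) \<le> cos (\<theta> k)"
      by (rule sum_of_compressions_shift_triple_le[OF _ _ sum[unfolded M_def], rotated])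
    moreover have "cos (\<theta> k) < cos (\<theta> (k + 1))"
      using \<theta> by (intro cos_monotone_0_pi) auto
    ultimately show False by linarith
  qed
  then show ?thesis
    using lmi_definition_shift_triple by (intro exI[of _ M]) (auto simp: M_def)
qed

end
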